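(* Let $B,K\ge 1$ be integers, let $\mathbf{Y}\in\mathbb{C}^{B\times(K+1)}$, let $\mathbf{G}=\mathbf{Y}^H\mathbf{Y}$, and assume $G_{1,1}\neq 0$. Let $\mathcal{O}\subset\mathbb{C}$ be a finite non-empty constant-modulus set (i.e., there is $\sigma>0$ with $|s|=\sigma$ for all $s\in\mathcal{O}$), let $\mathcal{C}_{\mathcal{O}}$ be its convex hull, and let $\check{s}\in\mathcal{O}$. Suppose that the real parameters $\alpha$ and $\beta$ satisfy $\alpha>\|\mathbf{G}\|$ (spectral norm) and $\alpha>\beta$, and let $\theta=\frac{\alpha}{\alpha-\beta}$. Let the sequences $(\mathbf{q}^{(t)})_{t\ge 1}$ and $(\mathbf{s}^{(t)})_{t\ge 0}$ in $\mathbb{C}^{K+1}$ be generated by the PrOX algorithm: $\mathbf{s}^{(0)}=\check{s}\,(G_{1,1})^{-1}\mathbf{g}_1^c$, where $\mathbf{g}_1^c$ is the first column of $\mathbf{G}$, and for $t=1,2,\ldots$ $$\mathbf{q}^{(t)}=(\mathbf{I}-\alpha^{-1}\mathbf{G})^{-1}\mathbf{s}^{(t-1)},\qquad \mathbf{s}^{(t)}=\mathrm{prox}_{\mathcal{C}_{\mathcal{O}}^{K+1}}(\theta\,\mathbf{q}^{(t)}).$$ Then PrOX converges in the gradient sense, i.e., $$\lim_{t\to\infty}\nabla_{\mathbf{q}}f(\mathbf{q}^{(t)},\mathbf{s}^{(t)})=0.$$ Furthermore, any limit point of the sequence of iterates $(\mathbf{q}^{(t)},\mathbf{s}^{(t)})_{t\ge1}$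 is a stationary point of $f$.
   Context: The set $\mathcal{C}_{\mathcal{O}}^{K+1}\subset\mathbb{C}^{K+1}$ is the $(K+1)$-fold Cartesian product of the convex hull $\mathcal{C}_{\mathcal{O}}\subset\mathbb{C}$. The proximal operator is the orthogonal projection $\mathrm{prox}_{\mathcal{C}_{\mathcal{O}}^{K+1}}(\mathbf{v})=\arg\min_{\mathbf{s}\in\mathcal{C}_{\mathcal{O}}^{K+1}}\|\mathbf{v}-\mathbf{s}\|_2^2$. The objective function $f:\mathbb{C}^{K+1}\times\mathbb{C}^{K+1}\to\mathbb{R}\cup\{\infty\}$ is $$f(\mathbf{q},\mathbf{s})=-\tfrac12\|\mathbf{Y}\mathbf{q}\|_2^2+\tfrac{\alpha}{2}\|\mathbf{q}-\mathbf{s}\|_2^2-\tfrac{\beta}{2}\|\mathbf{s}\|_2^2\ \text{ if }\mathbf{s}\in\mathcal{C}_{\mathcal{O}}^{K+1},\qquad f(\mathbf{q},\mathbf{s})=\infty\ \text{ otherwise.}$$ Gradients and sub-gradients are taken by regarding $\mathbb{C}^{K+1}$ as a real Euclidean space with inner product $\Re(\mathbf{x}^H\mathbf{y})$; thus, for $\mathbf{s}\in\mathcal{C}_{\mathcal{O}}^{K+1}$, $\nabla_{\mathbf{q}}f(\mathbf{q},\mathbf{s})=-\mathbf{G}\mathbf{q}+\alpha(\mathbf{q}-\mathbf{s})$. For $\alpha>\beta$ the function $f(\mathbf{q},\cdot)$ is convex for each fixed $\mathbf{q}$. A point $(\mathbf{q},\mathbf{s})$ with $\mathbf{s}\in\mathcal{C}_{\mathcal{O}}^{K+1}$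 is a stationary point of $f$ if $\nabla_{\mathbf{q}}f(\mathbf{q},\mathbf{s})=0$ and $0$ belongs to the (convex) subdifferential of $f(\mathbf{q},\cdot)$ at $\mathbf{s}$. *)

theory Defs
  imports "HOL-Analysis.Analysis"
begin

definition ctranspose :: "complex ^ 'n ^ 'm \<Rightarrow> complex ^ 'm ^ 'n" where
  "ctranspose A = (\<chi> i j. cnj (A $ j $ i))"

definition gram :: "complex ^ 'n ^ 'm \<Rightarrow> complex ^ 'n ^ 'n" where
  "gram Y = ctranspose Y ** Y"

text \<open>The norm on \<^typ>\<open>complex ^ 'n\<close> is Euclidean, so its operator norm is the spectral norm.\<close>

definition spectral_norm :: "complex ^ 'n ^ 'm \<Rightarrow> real" where
  "spectral_norm A = onorm ((*v) A)"

definition cart_power :: "'a set \<Rightarrow> ('a ^ 'n) set" where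
  "cart_power C = {v. \<forall>i. v $ i \<in> C}"

definition prox :: "'a::real_normed_vector set \<Rightarrow> 'a \<Rightarrow> 'a" where
  "prox C v = arg_min_on (\<lambda>s. (norm (v - s))\<^sup>2) C"

text \<open>Vectors of length \<open>K + 1\<close> are indexed by \<^typ>\<open>'k option\<close> with \<open>K = CARD('k) \<ge> 1\<close>;
  the index \<^term>\<open>None\<close> plays the role of the first index.\<close>

definition prox_objective ::
  "complex ^ ('k::finite) option ^ ('b::finite) \<Rightarrow> complex set \<Rightarrow> real \<Rightarrow> real \<Rightarrow>
   complex ^ 'k option \<Rightarrow> complex ^ 'k option \<Rightarrow> ereal" where
  "prox_objective Y \<O> \<alpha> \<beta> q s =
     (if s \<in> cart_power (convex hull \<O>)
      then ereal (- (1/2) * (norm (Y *v q))\<^sup>2 + \<alpha>/2 * (norm (q - s))\<^sup>2 - \<beta>/2 * (norm s)\<^sup>2)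
      else \<infinity>)"

text \<open>Gradients use the library inner product, which on \<^typ>\<open>complex ^ 'n\<close> is the real part of
  \<open>x\<^sup>H y\<close>.  The finiteness requirement is needed because \<^term>\<open>real_of_ereal\<close> maps
  infinite values to \<open>0\<close>.\<close>

definition has_gradient :: "('a::real_inner \<Rightarrow> ereal) \<Rightarrow> 'a \<Rightarrow> 'a \<Rightarrow> bool" where
  "has_gradient F x D \<longleftrightarrow>
     (\<forall>\<^sub>F y in nhds x. \<bar>F y\<bar> \<noteq> \<infinity>) \<and> (GDERIV (\<lambda>y. real_of_ereal (F y)) x :> D)"

definition gradient :: "('a::real_inner \<Rightarrow> ereal) \<Rightarrow> 'a \<Rightarrow> 'a" where
  "gradient F x = (THE D. has_gradient F x D)"

definition subdifferential :: "('a::real_inner \<Rightarrow> ereal) \<Rightarrow> 'a \<Rightarrow> 'a set" where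
  "subdifferential F x = {g. \<bar>F x\<bar> \<noteq> \<infinity> \<and> (\<forall>y. F y \<ge> F x + ereal (g \<bullet> (y - x)))}"

definition stationary_point ::
  "complex ^ ('k::finite) option ^ ('b::finite) \<Rightarrow> complex set \<Rightarrow> real \<Rightarrow> real \<Rightarrow>
   complex ^ 'k option \<Rightarrow> complex ^ 'k option \<Rightarrow> bool" where
  "stationary_point Y \<O> \<alpha> \<beta> q s \<longleftrightarrow>
     s \<in> cart_power (convex hull \<O>) \<and>
     has_gradient (\<lambda>q'. prox_objective Y \<O> \<alpha> \<beta> q' s) q 0 \<and>
     0 \<in> subdifferential (\<lambda>s'. prox_objective Y \<O> \<alpha> \<beta> q s') s"

text \<open>The value \<open>q 0\<close> is unconstrained: the sequence of the \<open>q t\<close> starts at \<open>t = 1\<close>.\<close>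

definition prox_iterates ::
  "complex ^ ('k::finite) option ^ ('b::finite) \<Rightarrow> complex set \<Rightarrow> complex \<Rightarrow> real \<Rightarrow> real \<Rightarrow>
   (nat \<Rightarrow> complex ^ 'k option) \<Rightarrow> (nat \<Rightarrow> complex ^ 'k option) \<Rightarrow> bool" where
  "prox_iterates Y \<O> s_check \<alpha> \<theta> q s \<longleftrightarrow>
     s 0 = (s_check * inverse (gram Y $ None $ None)) *s column None (gram Y) \<and>
     (\<forall>t\<ge>1. q t = matrix_inv (mat 1 - inverse \<alpha> *\<^sub>R gram Y) *v s (t - 1) \<and>
             s t = prox (cart_power (convex hull \<O>)) (\<theta> *\<^sub>R q t))"

text \<open>Limit points of a sequence are its cluster points, not the accumulation points of its range.\<close>

definition seq_limit_point :: "(nat \<Rightarrow> 'a::topological_space) \<Rightarrow> 'a \<Rightarrow> bool" where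
  "seq_limit_point X l \<longleftrightarrow> (\<exists>r::nat \<Rightarrow> nat. strict_mono r \<and> (X \<circ> r) \<longlonglongrightarrow> l)"

end

theory Submission
  imports Defs
begin

text \<open>The iteration is an alternating minimisation of \<open>f\<close>.  The \<open>q\<close>-step solves
  \<open>\<nabla>\<^sub>q f = 0\<close>, and \<open>f(\<cdot>, s)\<close> is strongly convex because \<open>\<alpha> > \<parallel>G\<parallel>\<close>, so it decreases \<open>f\<close>
  by at least \<open>(\<alpha> - \<parallel>G\<parallel>)/2 \<parallel>q\<^sup>t - q\<^sup>t\<^sup>+\<^sup>1\<parallel>\<^sup>2\<close>; the \<open>s\<close>-step does not increase \<open>f\<close>, since completing
  the square turns \<open>f(q, \<cdot>)\<close> into \<open>(\<alpha> - \<beta>)/2 \<parallel>s - \<theta>q\<parallel>\<^sup>2\<close> plus a constant.  As the iterates are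
  bounded, the decreases are summable, hence \<open>q\<^sup>t - q\<^sup>t\<^sup>+\<^sup>1 \<rightarrow> 0\<close>, and the gradient at
  \<open>(q\<^sup>t, s\<^sup>t)\<close> equals \<open>(\<alpha>I - G)(q\<^sup>t - q\<^sup>t\<^sup>+\<^sup>1)\<close>.  In the limit along a subsequence the gradient
  vanishes and \<open>s\<close> still minimises \<open>f(q, \<cdot>)\<close>, which is the subdifferential condition.\<close>

section \<open>Gram matrix, spectral norm and solvability of the \<open>q\<close>-step\<close>

lemma inner_ctranspose:
  fixes A :: "complex ^ 'n::finite ^ 'm::finite"
  shows "inner x (ctranspose A *v y) = inner (A *v x) y"
proof -
  have inner_Re: "inner u v = Re (cnj u * v)" for u v :: complex
    by (simp add: inner_complex_def)
  have "inner x (ctranspose A *v y)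
      = (\<Sum>i\<in>UNIV. \<Sum>j\<in>UNIV. Re (cnj (x $ i) * (cnj (A $ j $ i) * y $ j)))"
    by (simp add: inner_vec_def inner_Re ctranspose_def matrix_vector_mult_def sum_distrib_left
        del: complex_cnj_mult times_complex.sel)
  also have "\<dots> = (\<Sum>j\<in>UNIV. \<Sum>i\<in>UNIV. Re (cnj (x $ i) * (cnj (A $ j $ i) * y $ j)))"
    by (rule sum.swap)
  also have "\<dots> = inner (A *v x) y"
    by (simp add: inner_vec_def inner_Re matrix_vector_mult_def sum_distrib_left sum_distrib_right mult_ac
        del: times_complex.sel)
  finally show ?thesis .
qed

lemma inner_gram:
  fixes Y :: "complex ^ 'n::finite ^ 'm::finite"
  shows "inner x (gram Y *v y) = inner (Y *v x) (Y *v y)"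
  by (simp add: gram_def inner_ctranspose flip: matrix_vector_mul_assoc)

lemma spectral_norm_nonneg: "spectral_norm A \<ge> 0"
  for A :: "complex ^ 'n::finite ^ 'm::finite"
  unfolding spectral_norm_def by (rule onorm_pos_le) simp

lemma norm_mult_le_spectral_norm: "norm (A *v x) \<le> spectral_norm A * norm x"
  for A :: "complex ^ 'n::finite ^ 'm::finite"
  unfolding spectral_norm_def by (rule onorm) simp

text \<open>Cauchy-Schwarz applied to the quadratic form of \<open>gram Y\<close>. Compared with
  \<alpha>, it bounds from below the curvature of the objective in \<open>q\<close>.\<close>

lemma norm_mult_sq_le_spectral_norm_gram:
  fixes Y :: "complex ^ 'n::finite ^ 'm::finite"
  shows "(norm (Y *v x))\<^sup>2 \<le> spectral_norm (gram Y) * (norm x)\<^sup>2"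
proof -
  have "(norm (Y *v x))\<^sup>2 = inner x (gram Y *v x)"
    by (simp add: inner_gram power2_norm_eq_inner)
  also have "\<dots> \<le> norm x * norm (gram Y *v x)"
    by (rule norm_cauchy_schwarz)
  also have "\<dots> \<le> norm x * (spectral_norm (gram Y) * norm x)"
    by (intro mult_left_mono norm_mult_le_spectral_norm) simp
  finally show ?thesis by (simp add: power2_eq_square mult_ac)
qed

lemma scaleR_matrix_mult_vec: "(k *\<^sub>R A) *v v = k *\<^sub>R (A *v v)"
  for A :: "'a::real_algebra_1 ^ 'n::finite ^ 'm"
  by (simp add: vec_eq_iff matrix_vector_mult_def scaleR_sum_right)

text \<open>A kernel vector \<open>v\<close> of the matrix satisfies
  \<open>\<alpha> *\<^sub>R v = A *v v\<close>, which the norm bound allows only for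
  \<open>v = 0\<close>; a square matrix with trivial kernel is invertible.\<close>

lemma matrix_inv_mult_vec:
  fixes A :: "complex ^ 'n::finite ^ 'n"
  assumes "spectral_norm A < \<alpha>"
  shows "(mat 1 - inverse \<alpha> *\<^sub>R A) *v (matrix_inv (mat 1 - inverse \<alpha> *\<^sub>R A) *v x) = x"
proof -
  let ?M = "mat 1 - inverse \<alpha> *\<^sub>R A"
  have "\<alpha> > 0" using spectral_norm_nonneg[of A] assms by linarith
  have "v = 0" if "?M *v v = 0" for v
  proof -
    have "v = inverse \<alpha> *\<^sub>R (A *v v)"
      using that by (simp add: matrix_vector_mult_diff_rdistrib scaleR_matrix_mult_vec)
    then have "\<alpha> *\<^sub>R v = A *v v"
      using \<open>\<alpha> > 0\<close> by (metis divideR_right less_irrefl)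
    then have "\<alpha> * norm v = norm (A *v v)"
      using \<open>\<alpha> > 0\<close> by (metis abs_of_pos norm_scaleR)
    also have "\<dots> \<le> spectral_norm A * norm v"
      by (rule norm_mult_le_spectral_norm)
    finally show "v = 0"
      using assms by (metis mult_le_cancel_right norm_le_zero_iff not_le)
  qed
  then have "invertible ?M"
    by (metis invertible_left_inverse matrix_left_invertible_ker)
  then have "?M ** matrix_inv ?M = mat 1"
    unfolding invertible_def matrix_inv_def by (rule someI2_ex) simp
  then show ?thesis by (simp add: matrix_vector_mul_assoc)
qed

section \<open>Compactness of the constraint set and existence of projections\<close>

lemma compact_cart_power:
  fixes C :: "'a::euclidean_space set"
  assumes "compact C"
  shows "compact (cart_power C :: ('a ^ 'n::finite) set)"
proof -
  obtain B where B: "norm x \<le> B" if "x \<in> C" for x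
    using assms compact_imp_bounded bounded_iff by metis
  have "norm v \<le> real CARD('n) * B" if "v \<in> cart_power C" for v :: "'a ^ 'n"
  proof -
    have "norm v \<le> (\<Sum>i\<in>UNIV. norm (v $ i))"
      unfolding norm_vec_def by (rule L2_set_le_sum) simp
    also have "\<dots> \<le> real CARD('n) * B"
      using that by (intro sum_bounded_above B) (simp add: cart_power_def)
    finally show ?thesis .
  qed
  then have "bounded (cart_power C :: ('a ^ 'n) set)"
    unfolding bounded_iff by blast
  moreover have "closed (cart_power C :: ('a ^ 'n) set)"
    unfolding cart_power_def using assms by (intro closed_vector_box) (simp add: compact_imp_closed)
  ultimately show ?thesis by (simp add: compact_eq_bounded_closed)
qed

text \<open>A continuous function attains its minimum on a non-empty compact set, so the choice made
  by \<open>arg_min_on\<close> is a genuine minimiser.\<close>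

lemma prox_minimizes:
  fixes C :: "'a::real_normed_vector set"
  assumes "compact C" "C \<noteq> {}"
  shows "prox C v \<in> C" and "x \<in> C \<Longrightarrow> norm (v - prox C v) \<le> norm (v - x)"
proof -
  have "continuous_on C (\<lambda>s. (norm (v - s))\<^sup>2)"
    by (intro continuous_intros)
  then obtain m where m: "m \<in> C" "\<And>y. y \<in> C \<Longrightarrow> (norm (v - m))\<^sup>2 \<le> (norm (v - y))\<^sup>2"
    using continuous_attains_inf[OF assms] by blast
  have "prox C v \<in> C \<and> (\<forall>y\<in>C. (norm (v - prox C v))\<^sup>2 \<le> (norm (v - y))\<^sup>2)"
    unfolding prox_def arg_min_on_def
    by (rule arg_minI[of "\<lambda>x. x \<in> C", OF m(1)]) (use m in \<open>auto simp: not_less\<close>)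
  then show "prox C v \<in> C" and "x \<in> C \<Longrightarrow> norm (v - prox C v) \<le> norm (v - x)"
    by (auto simp: abs_le_square_iff[symmetric])
qed

section \<open>The finite part of the objective\<close>

text \<open>Dropping the constraint on \<open>s\<close> keeps expansions, limits and derivatives
  within the reals.\<close>

definition smooth_objective ::
  "complex ^ 'n::finite ^ 'm::finite \<Rightarrow> real \<Rightarrow> real \<Rightarrow> complex ^ 'n \<Rightarrow> complex ^ 'n \<Rightarrow> real" where
  "smooth_objective Y \<alpha> \<beta> q s =
     - (1/2) * (norm (Y *v q))\<^sup>2 + \<alpha>/2 * (norm (q - s))\<^sup>2 - \<beta>/2 * (norm s)\<^sup>2"

text \<open>The gradient is in \<open>q\<close> for fixed \<open>s\<close>; the \<beta> term depends
  on \<open>s\<close> alone and drops out.\<close>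

definition smooth_gradient ::
  "complex ^ 'n::finite ^ 'm::finite \<Rightarrow> real \<Rightarrow> complex ^ 'n \<Rightarrow> complex ^ 'n \<Rightarrow> complex ^ 'n" where
  "smooth_gradient Y \<alpha> q s = \<alpha> *\<^sub>R (q - s) - gram Y *v q"

lemma prox_objective_eq:
  "prox_objective Y \<O> \<alpha> \<beta> q s =
     (if s \<in> cart_power (convex hull \<O>) then ereal (smooth_objective Y \<alpha> \<beta> q s) else \<infinity>)"
  by (simp add: prox_objective_def smooth_objective_def)

text \<open>The objective is quadratic in \<open>q\<close>, so its second-order Taylor expansion is
  exact.\<close>

lemma smooth_objective_expand:
  "smooth_objective Y \<alpha> \<beta> (q + h) s = smooth_objective Y \<alpha> \<beta> q s
     + inner h (smooth_gradient Y \<alpha> q s) + 1/2 * (\<alpha> * (norm h)\<^sup>2 - (norm (Y *v h))\<^sup>2)"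
  unfolding smooth_objective_def smooth_gradient_def inner_diff_right inner_gram
    power2_norm_eq_inner matrix_vector_right_distrib
  by (simp add: inner_commute algebra_simps field_simps)

text \<open>Taking a difference cancels the terms in \<open>q\<close> alone. Projecting the scaled
  \<open>q\<close> is thus the same as minimising over \<open>s\<close>.\<close>

lemma smooth_objective_complete_square:
  assumes "\<alpha> > \<beta>"
  shows "smooth_objective Y \<alpha> \<beta> q x - smooth_objective Y \<alpha> \<beta> q y
    = (\<alpha> - \<beta>) / 2 * ((norm ((\<alpha> / (\<alpha> - \<beta>)) *\<^sub>R q - x))\<^sup>2 - (norm ((\<alpha> / (\<alpha> - \<beta>)) *\<^sub>R q - y))\<^sup>2)"
proof -
  \<comment> \<open>Expressing \<alpha> and \<beta> through \<open>c\<close> and \<open>k\<close>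
    removes the quotient and leaves a polynomial identity.\<close>
  define c k where "c = \<alpha> - \<beta>" and "k = \<alpha> / c"
  have \<alpha>: "\<alpha> = c * k" and \<beta>: "\<beta> = c * k - c"
    using assms by (auto simp: c_def k_def)
  have "smooth_objective Y \<alpha> \<beta> q x - smooth_objective Y \<alpha> \<beta> q y
      = c / 2 * ((norm (k *\<^sub>R q - x))\<^sup>2 - (norm (k *\<^sub>R q - y))\<^sup>2)"
    unfolding smooth_objective_def power2_norm_eq_inner \<alpha> \<beta>
    by (simp add: inner_commute algebra_simps add_divide_distrib diff_divide_distrib)
  then show ?thesis by (simp add: c_def k_def)
qed

lemma continuous_on_smooth_objective:
  fixes f g :: "'a::topological_space \<Rightarrow> complex ^ 'n::finite"
  assumes "continuous_on S f" "continuous_on S g"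
  shows "continuous_on S (\<lambda>x. smooth_objective Y \<alpha> \<beta> (f x) (g x))"
  unfolding smooth_objective_def
  by (intro continuous_intros assms bounded_linear.continuous_on[OF matrix_vector_mul_bounded_linear])

lemma tendsto_smooth_objective:
  assumes "(f \<longlongrightarrow> a) F" "(g \<longlongrightarrow> b) F"
  shows "((\<lambda>x. smooth_objective Y \<alpha> \<beta> (f x) (g x)) \<longlongrightarrow> smooth_objective Y \<alpha> \<beta> a b) F"
  unfolding smooth_objective_def
  by (intro tendsto_intros assms bounded_linear.tendsto[OF matrix_vector_mul_bounded_linear])

lemma tendsto_smooth_gradient:
  assumes "(f \<longlongrightarrow> a) F" "(g \<longlongrightarrow> b) F"
  shows "((\<lambda>x. smooth_gradient Y \<alpha> (f x) (g x)) \<longlongrightarrow> smooth_gradient Y \<alpha> a b) F"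
  unfolding smooth_gradient_def
  by (intro tendsto_intros assms bounded_linear.tendsto[OF matrix_vector_mul_bounded_linear])

lemma GDERIV_smooth_objective:
  "GDERIV (\<lambda>q. smooth_objective Y \<alpha> \<beta> q s) q :> smooth_gradient Y \<alpha> q s"
proof -
  note [derivative_intros] =
    bounded_linear.has_derivative[OF matrix_vector_mul_bounded_linear]
  show ?thesis
    unfolding gderiv_def smooth_objective_def smooth_gradient_def power2_norm_eq_inner
      inner_diff_right inner_gram
    by (auto intro!: derivative_eq_intros simp: fun_eq_iff inner_commute algebra_simps)
qed

section \<open>Gradients and subgradients of extended-valued functions\<close>

lemma has_gradient_prox_objective:
  assumes "s \<in> cart_power (convex hull \<O>)"
  shows "has_gradient (\<lambda>q. prox_objective Y \<O> \<alpha> \<beta> q s) q (smooth_gradient Y \<alpha> q s)"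
  using assms GDERIV_smooth_objective by (simp add: has_gradient_def prox_objective_eq)

text \<open>Justifies the \<open>THE\<close> in \<open>gradient\<close>: the derivative is unique,
  and the inner product determines the vector representing it.\<close>

lemma has_gradient_unique:
  assumes "has_gradient F x D" "has_gradient F x E"
  shows "D = E"
proof -
  have "(\<lambda>h. inner h D) = (\<lambda>h. inner h E)"
    using assms unfolding has_gradient_def gderiv_def by (blast intro: has_derivative_unique)
  then have "inner (D - E) (D - E) = 0"
    by (metis inner_diff_right right_minus_eq)
  then show ?thesis by simp
qed

lemma gradient_eqI: "has_gradient F x D \<Longrightarrow> gradient F x = D"
  unfolding gradient_def by (blast intro: has_gradient_unique)

text \<open>Fermat's rule: with subgradient zero the linear term vanishes.\<close>

lemma zero_in_subdifferential_iff:
  "0 \<in> subdifferential F x \<longleftrightarrow> \<bar>F x\<bar> \<noteq> \<infinity> \<and> (\<forall>y. F x \<le> F y)"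
  by (simp add: subdifferential_def flip: zero_ereal_def)

section \<open>Descent and convergence of the iterates\<close>

text \<open>Telescoping bounds the partial sums of \<open>b\<close>, so this nonnegative series
  converges and its terms vanish.\<close>

lemma descent_imp_tendsto_zero:
  fixes a b :: "nat \<Rightarrow> real"
  assumes descent: "\<And>n. a (Suc n) + b n \<le> a n" and lower: "\<And>n. L \<le> a n" and nonneg: "\<And>n. 0 \<le> b n"
  shows "b \<longlonglongrightarrow> 0"
proof -
  have "sum b {..n} \<le> a 0 - a (Suc n)" for n
  proof (induction n)
    case 0
    show ?case using descent[of 0] by simp
  next
    case (Suc n)
    then show ?case using descent[of "Suc n"] by simp
  qed
  then have "sum b {..n} \<le> a 0 - L" for n
    using lower by (meson diff_left_mono order.trans)
  then show ?thesis
    using nonneg by (intro summable_LIMSEQ_zero bounded_imp_summable)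
qed

text \<open>Indices start at \<open>Suc t\<close> because \<open>q 0\<close> is arbitrary and
  \<open>s 0\<close> may lie outside \<open>C\<close>.\<close>

lemma prox_iterates_converge:
  fixes Y :: "complex ^ ('k::finite) option ^ ('b::finite)"
  assumes "finite \<O>" "\<O> \<noteq> {}" and \<alpha>: "\<alpha> > spectral_norm (gram Y)" and "\<alpha> > \<beta>"
    and iter: "prox_iterates Y \<O> s_check \<alpha> (\<alpha> / (\<alpha> - \<beta>)) q s"
  defines "C \<equiv> cart_power (convex hull \<O>)"
  shows "s (Suc t) \<in> C"
    and "y \<in> C \<Longrightarrow> smooth_objective Y \<alpha> \<beta> (q (Suc t)) (s (Suc t)) \<le> smooth_objective Y \<alpha> \<beta> (q (Suc t)) y"
    and "(\<lambda>t. smooth_gradient Y \<alpha> (q (Suc t)) (s (Suc t))) \<longlonglongrightarrow> 0"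
proof -
  let ?\<phi> = "smooth_objective Y \<alpha> \<beta>"
  let ?M = "mat 1 - inverse \<alpha> *\<^sub>R gram Y"
  have q: "q (Suc t) = matrix_inv ?M *v s t"
    and s: "s (Suc t) = prox C ((\<alpha> / (\<alpha> - \<beta>)) *\<^sub>R q (Suc t))" for t
    using iter by (simp_all add: prox_iterates_def C_def)
  have "\<alpha> > 0" using spectral_norm_nonneg[of "gram Y"] \<alpha> by linarith
  have C: "compact C"
    unfolding C_def using assms(1) by (intro compact_cart_power finite_imp_compact_convex_hull)
  obtain z where "z \<in> \<O>" using assms(2) by blast
  then have "(\<chi> i. z) \<in> C" by (simp add: C_def cart_power_def hull_inc)
  then have "C \<noteq> {}" by blast
  note prox = prox_minimizes[OF C \<open>C \<noteq> {}\<close>]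
  show sC: "s (Suc t) \<in> C" for t
    unfolding s by (rule prox)
  show s_min: "?\<phi> (q (Suc t)) (s (Suc t)) \<le> ?\<phi> (q (Suc t)) y" if "y \<in> C" for t y
  proof -
    let ?v = "(\<alpha> / (\<alpha> - \<beta>)) *\<^sub>R q (Suc t)"
    have "(norm (?v - s (Suc t)))\<^sup>2 \<le> (norm (?v - y))\<^sup>2"
      unfolding s using prox(2)[OF that] by (intro power_mono) auto
    then have "0 \<le> ?\<phi> (q (Suc t)) y - ?\<phi> (q (Suc t)) (s (Suc t))"
      unfolding smooth_objective_complete_square[OF \<open>\<alpha> > \<beta>\<close>]
      using \<open>\<alpha> > \<beta>\<close> by (intro mult_nonneg_nonneg) auto
    then show ?thesis by simp
  qed
  \<comment> \<open>Multiplying \<open>s t = ?M *v q (Suc t)\<close> by \<alpha> gives stationarity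
    in \<open>q\<close>, with the new \<open>q\<close> paired with the previous
    \<open>s\<close>.\<close>
  have q_stat: "smooth_gradient Y \<alpha> (q (Suc t)) (s t) = 0" for t
  proof -
    have "s t = ?M *v q (Suc t)"
      unfolding q using matrix_inv_mult_vec[OF \<alpha>] by simp
    then have "s t = q (Suc t) - inverse \<alpha> *\<^sub>R (gram Y *v q (Suc t))"
      by (simp add: matrix_vector_mult_diff_rdistrib scaleR_matrix_mult_vec)
    then show ?thesis
      using \<open>\<alpha> > 0\<close> by (simp add: smooth_gradient_def)
  qed
  define d where "d t = q (Suc t) - q (Suc (Suc t))" for t
  define b where "b t = (\<alpha> - spectral_norm (gram Y)) / 2 * (norm (d t))\<^sup>2" for t
  have descent: "?\<phi> (q (Suc (Suc t))) (s (Suc (Suc t))) + b t \<le> ?\<phi> (q (Suc t)) (s (Suc t))" for t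
  proof -
    have "?\<phi> (q (Suc t)) (s (Suc t)) = ?\<phi> (q (Suc (Suc t)) + d t) (s (Suc t))"
      by (simp add: d_def)
    \<comment> \<open>Expanding around the new point \<open>q (Suc (Suc t))\<close> lets
      \<open>q_stat\<close> remove the linear term.\<close>
    also have "\<dots> = ?\<phi> (q (Suc (Suc t))) (s (Suc t)) + 1/2 * (\<alpha> * (norm (d t))\<^sup>2 - (norm (Y *v d t))\<^sup>2)"
      unfolding smooth_objective_expand q_stat by simp
    finally show ?thesis
      using s_min[OF sC, of "Suc t" t] norm_mult_sq_le_spectral_norm_gram[of Y "d t"]
      unfolding b_def by (simp add: field_simps)
  qed
  \<comment> \<open>Each \<open>q\<close> is a linear image of the preceding \<open>s\<close>, so
    from the second iteration on the objective values lie in a continuous image of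
    \<open>C \<times> C\<close>.\<close>
  have "compact ((\<lambda>(x, y). ?\<phi> (matrix_inv ?M *v x) y) ` (C \<times> C))"
    unfolding case_prod_beta
    by (intro compact_continuous_image continuous_on_smooth_objective compact_Times C continuous_intros
        bounded_linear.continuous_on[OF matrix_vector_mul_bounded_linear])
  then obtain B where B: "\<bar>?\<phi> (matrix_inv ?M *v x) y\<bar> \<le> B" if "x \<in> C" "y \<in> C" for x y
    by (force dest!: compact_imp_bounded simp: bounded_iff)
  have lower: "- B \<le> ?\<phi> (q (Suc (Suc t))) (s (Suc (Suc t)))" for t
    using B[OF sC sC, of t "Suc t"] unfolding q[of "Suc t"] by simp
  \<comment> \<open>The extra shift matches \<open>lower\<close>: the first \<open>q\<close> comes
    from \<open>s 0\<close>, to which the compactness bound does not apply.\<close>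
  have "(\<lambda>t. b (Suc t)) \<longlonglongrightarrow> 0"
    using descent lower \<alpha>
    by (intro descent_imp_tendsto_zero[where a = "\<lambda>t. ?\<phi> (q (Suc (Suc t))) (s (Suc (Suc t)))"])
      (auto simp: b_def)
  then have "b \<longlonglongrightarrow> 0" by (rule LIMSEQ_imp_Suc)
  then have "(\<lambda>t. 2 / (\<alpha> - spectral_norm (gram Y)) * b t) \<longlonglongrightarrow> 0"
    by (rule tendsto_mult_right_zero)
  then have "(\<lambda>t. (norm (d t))\<^sup>2) \<longlonglongrightarrow> 0"
    using \<alpha> by (simp add: b_def)
  then have d0: "d \<longlonglongrightarrow> 0"
    by (simp add: tendsto_norm_zero_iff)
  \<comment> \<open>Subtracting the zero gradient at \<open>(q (Suc (Suc t)), s (Suc t))\<close>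
    eliminates \<open>s (Suc t)\<close>.\<close>
  have "smooth_gradient Y \<alpha> (q (Suc t)) (s (Suc t)) = \<alpha> *\<^sub>R d t - gram Y *v d t" for t
    using q_stat[of "Suc t"]
    by (simp add: smooth_gradient_def d_def matrix_vector_mult_diff_distrib algebra_simps)
  moreover have "(\<lambda>t. \<alpha> *\<^sub>R d t - gram Y *v d t) \<longlonglongrightarrow> \<alpha> *\<^sub>R 0 - gram Y *v 0"
    by (intro tendsto_intros d0 bounded_linear.tendsto[OF matrix_vector_mul_bounded_linear])
  ultimately show "(\<lambda>t. smooth_gradient Y \<alpha> (q (Suc t)) (s (Suc t))) \<longlonglongrightarrow> 0"
    by simp
qed

section \<open>Vanishing gradients and stationarity of limit points\<close>

theorem theorem1:
  fixes Y :: "complex ^ ('k::finite) option ^ ('b::finite)"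
    and \<O> :: "complex set"
    and s_check :: complex
    and \<alpha> \<beta> \<theta> \<sigma> :: real
    and q s :: "nat \<Rightarrow> complex ^ 'k option"
  assumes "gram Y $ None $ None \<noteq> 0"
    and "finite \<O>" and "\<O> \<noteq> {}"
    and "\<sigma> > 0" and "\<forall>x\<in>\<O>. cmod x = \<sigma>"
    and "s_check \<in> \<O>"
    and "\<alpha> > spectral_norm (gram Y)" and "\<alpha> > \<beta>"
    and "\<theta> = \<alpha> / (\<alpha> - \<beta>)"
    and "prox_iterates Y \<O> s_check \<alpha> \<theta> q s"
  shows "((\<lambda>t. gradient (\<lambda>q'. prox_objective Y \<O> \<alpha> \<beta> q' (s t)) (q t)) \<longlonglongrightarrow> 0) \<and>
         (\<forall>q_lim s_lim. seq_limit_point (\<lambda>t. (q (Suc t), s (Suc t))) (q_lim, s_lim)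
              \<longrightarrow> stationary_point Y \<O> \<alpha> \<beta> q_lim s_lim)"
proof (intro conjI allI impI)
  note iter = prox_iterates_converge[OF assms(2,3,7,8) assms(10)[unfolded assms(9)]]
  have "(\<lambda>t. gradient (\<lambda>q'. prox_objective Y \<O> \<alpha> \<beta> q' (s (Suc t))) (q (Suc t))) \<longlonglongrightarrow> 0"
    using iter(3) by (simp add: gradient_eqI[OF has_gradient_prox_objective[OF iter(1)]])
  then show "(\<lambda>t. gradient (\<lambda>q'. prox_objective Y \<O> \<alpha> \<beta> q' (s t)) (q t)) \<longlonglongrightarrow> 0"
    \<comment> \<open>The single term at \<open>t = 0\<close>, where \<open>q 0\<close> is
      arbitrary, does not affect the limit.\<close>
    by (rule LIMSEQ_imp_Suc)
next
  let ?C = "cart_power (convex hull \<O>) :: (complex ^ 'k option) set"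
  let ?\<phi> = "smooth_objective Y \<alpha> \<beta>"
  note iter = prox_iterates_converge[OF assms(2,3,7,8) assms(10)[unfolded assms(9)]]
  fix q_lim s_lim
  assume "seq_limit_point (\<lambda>t. (q (Suc t), s (Suc t))) (q_lim, s_lim)"
  then obtain r :: "nat \<Rightarrow> nat" where r: "strict_mono r"
    and lim: "(\<lambda>n. (q (Suc (r n)), s (Suc (r n)))) \<longlonglongrightarrow> (q_lim, s_lim)"
    by (auto simp: seq_limit_point_def o_def)
  have ql: "(\<lambda>n. q (Suc (r n))) \<longlonglongrightarrow> q_lim" and sl: "(\<lambda>n. s (Suc (r n))) \<longlonglongrightarrow> s_lim"
    using tendsto_fst[OF lim] tendsto_snd[OF lim] by simp_all
  have "closed ?C"
    using assms(2) by (intro compact_imp_closed compact_cart_power finite_imp_compact_convex_hull)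
  then have sC: "s_lim \<in> ?C"
    by (rule closed_sequentially[OF _ iter(1) sl])
  have "(\<lambda>n. smooth_gradient Y \<alpha> (q (Suc (r n))) (s (Suc (r n)))) \<longlonglongrightarrow> 0"
    using LIMSEQ_subseq_LIMSEQ[OF iter(3) r] by (simp add: o_def)
  then have "smooth_gradient Y \<alpha> q_lim s_lim = 0"
    using tendsto_smooth_gradient[OF ql sl] LIMSEQ_unique by blast
  then have grad: "has_gradient (\<lambda>q'. prox_objective Y \<O> \<alpha> \<beta> q' s_lim) q_lim 0"
    using has_gradient_prox_objective[OF sC] by metis
  \<comment> \<open>Every iterate is compared with the same fixed competitor \<open>y\<close>, so
    the inequality passes to the limit by continuity.\<close>
  have "?\<phi> q_lim s_lim \<le> ?\<phi> q_lim y" if "y \<in> ?C" for y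
    using iter(2)[OF that]
    by (intro LIMSEQ_le[OF tendsto_smooth_objective[OF ql sl]
          tendsto_smooth_objective[OF ql tendsto_const]]) auto
  then have "0 \<in> subdifferential (\<lambda>s'. prox_objective Y \<O> \<alpha> \<beta> q_lim s') s_lim"
    using sC by (simp add: zero_in_subdifferential_iff prox_objective_eq)
  with sC grad show "stationary_point Y \<O> \<alpha> \<beta> q_lim s_lim"
    by (simp add: stationary_point_def)
qed

end
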